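(* Let $G$ be an Abelian group and $S$ a subsemigroup of $G$ with $0\in S$. The following conditions are equivalent: (1) the space $G_S$ is sequentially compact; (2) the space $G_S$ is countably compact; (3) for each cardinal $\kappa$ the power $G_S^\kappa$ of the space $G_S$ is countably compact; (4) the space $G_S$ is countably o-compact; (5) the paratopological group $G_S$ is $2$-pseudocompact; (6) the subgroup $S-S$ has finite index in $G$ and each countable subset $C\subseteq S-S$ is contained in $a-S$ for some $a\in S$; (7) the subgroup $S-S$ has finite index in $G$ and each countable subset $C\subseteq S$ is contained in $a-S$ for some $a\in S$; (8) the subgroup $S-S$ has finite index in $G$ and each infinite subset $C\subseteq S$ has infinite intersection with the set $a-S$ for some $a\in S$; (9) each infinite subset $C\subseteq G$ has infinite intersection with the set $a-S$ for some $a\in G$.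
   Context: For an Abelian group $G$ (written additively) and a subsemigroup $S\ni 0$ of $G$, $G_S$ denotes the group $G$ endowed with the topology consisting of all sets $A+S$ with $A\subseteq G$; it is a paratopological group (addition is continuous). Here $S-S=\{s-t:s,t\in S\}$ and $a-S=\{a-s:s\in S\}$. Powers carry the Tychonoff product topology. A space $X$ is sequentially compact if each sequence in $X$ has a convergent subsequence; countably compact if each infinite $B\subseteq X$ has an accumulation point $x\in X$ (each neighborhood of $x$ contains infinitely many points of $B$), equivalently each countable open cover has a finite subcover; countably o-compact if each decreasing sequence $(U_n)_{n\in\omega}$ of nonempty open sets has $\bigcap_{n}U_n\neq\emptyset$. A paratopological group (written additively) is $2$-pseudocompact if $\bigcap_{n\in\omega}\overline{-U_n}\ne\emptyset$ for each decreasing sequence $(U_n)_{n\in\omega}$ of nonempty open subsets. No separation axioms are assumed. *)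

theory Defs
  imports "HOL-Analysis.Analysis" "HOL-Library.Set_Algebras"
begin

definition subsemigroup :: "'a::ab_group_add set \<Rightarrow> bool" where
  "subsemigroup S \<longleftrightarrow> (\<forall>x\<in>S. \<forall>y\<in>S. x + y \<in> S)"

text \<open>The space \<open>G\<^sub>S\<close>. Here \<open>A + S\<close> is the Minkowski sum of sets. The predicate is a
  topology when \<open>S\<close> is a subsemigroup containing \<open>0\<close>, see \<open>openin_semigroup_topology\<close> below.\<close>

definition semigroup_topology :: "'a::ab_group_add set \<Rightarrow> 'a topology" where
  "semigroup_topology S = topology (\<lambda>U. \<exists>A. U = A + S)"

text \<open>On sets, the infix minus sign denotes set difference, hence the separate notion.\<close>

definition set_differences :: "'a::ab_group_add set \<Rightarrow> 'a set" where
  "set_differences S = {s - t | s t. s \<in> S \<and> t \<in> S}"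

definition reflected_translate :: "'a::ab_group_add \<Rightarrow> 'a set \<Rightarrow> 'a set" where
  "reflected_translate a S = {a - s | s. s \<in> S}"

definition finite_index :: "'a::ab_group_add set \<Rightarrow> bool" where
  "finite_index H \<longleftrightarrow> finite (range (\<lambda>x. x +o H))"

definition sequentially_compact_space :: "'a topology \<Rightarrow> bool" where
  "sequentially_compact_space X \<longleftrightarrow>
     (\<forall>f::nat \<Rightarrow> 'a. range f \<subseteq> topspace X \<longrightarrow>
        (\<exists>l r. strict_mono r \<and> limitin X (f \<circ> r) l sequentially))"

definition countably_compact_space :: "'a topology \<Rightarrow> bool" where
  "countably_compact_space X \<longleftrightarrow>
     (\<forall>B. B \<subseteq> topspace X \<and> infinite B \<longrightarrow>
        (\<exists>x\<in>topspace X. \<forall>U. openin X U \<and> x \<in> U \<longrightarrow> infinite (U \<inter> B)))"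

definition countably_o_compact_space :: "'a topology \<Rightarrow> bool" where
  "countably_o_compact_space X \<longleftrightarrow>
     (\<forall>U::nat \<Rightarrow> 'a set. (\<forall>n. openin X (U n) \<and> U n \<noteq> {}) \<and> decseq U \<longrightarrow>
        (\<Inter>n. U n) \<noteq> {})"

definition two_pseudocompact :: "'a::ab_group_add topology \<Rightarrow> bool" where
  "two_pseudocompact X \<longleftrightarrow>
     (\<forall>U::nat \<Rightarrow> 'a set. (\<forall>n. openin X (U n) \<and> U n \<noteq> {}) \<and> decseq U \<longrightarrow>
        (\<Inter>n. X closure_of (uminus ` U n)) \<noteq> {})"

lemma openin_semigroup_topology_iff:
  assumes "subsemigroup S" "0 \<in> S"
  shows "openin (semigroup_topology S) U \<longleftrightarrow> (\<forall>x\<in>U. \<forall>s\<in>S. x + s \<in> U)"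
    and "openin (semigroup_topology S) U \<longleftrightarrow> (\<exists>A. U = A + S)"
proof -
  have *: "(\<exists>A. U = A + S) \<longleftrightarrow> (\<forall>x\<in>U. \<forall>s\<in>S. x + s \<in> U)" for U
  proof
    assume "\<exists>A. U = A + S"
    then show "\<forall>x\<in>U. \<forall>s\<in>S. x + s \<in> U"
      using assms(1) unfolding subsemigroup_def
      by (auto simp: set_plus_def add.assoc) blast
  next
    assume u: "\<forall>x\<in>U. \<forall>s\<in>S. x + s \<in> U"
    have "U = U + S"
    proof
      show "U \<subseteq> U + S" using assms(2) by (metis add.right_neutral set_plus_intro subsetI)
      show "U + S \<subseteq> U" using u by (auto simp: set_plus_def)
    qed
    then show "\<exists>A. U = A + S" by blast
  qed
  have "istopology (\<lambda>U. \<exists>A. U = A + S)"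
    unfolding * istopology_def by blast
  then have "openin (semigroup_topology S) = (\<lambda>U. \<exists>A. U = A + S)"
    unfolding semigroup_topology_def by (rule topology_inverse')
  then show "openin (semigroup_topology S) U \<longleftrightarrow> (\<forall>x\<in>U. \<forall>s\<in>S. x + s \<in> U)"
    and "openin (semigroup_topology S) U \<longleftrightarrow> (\<exists>A. U = A + S)"
    using * by simp_all
qed

lemmas openin_semigroup_topology = openin_semigroup_topology_iff(2)

lemma topspace_semigroup_topology:
  assumes "subsemigroup S" "0 \<in> S"
  shows "topspace (semigroup_topology S) = UNIV"
  using openin_subset[of "semigroup_topology S" UNIV] openin_semigroup_topology_iff(1)[OF assms, of UNIV]
  by auto

lemma continuous_map_add_semigroup_topology:
  assumes "subsemigroup S" "0 \<in> S"
  shows "continuous_map (prod_topology (semigroup_topology S) (semigroup_topology S))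
           (semigroup_topology S) (\<lambda>(x, y). x + y)"
proof -
  let ?X = "semigroup_topology S"
  have "openin (prod_topology ?X ?X) {p. fst p + snd p \<in> U}" if U: "openin ?X U" for U
    unfolding openin_prod_topology_alt
  proof (intro allI impI)
    fix x y assume "(x, y) \<in> {p. fst p + snd p \<in> U}"
    then have xy: "x + y \<in> U" by simp
    have op: "openin ?X ({z} + S)" for z
      using openin_semigroup_topology[OF assms] by blast
    have "{x} + S + ({y} + S) \<subseteq> U"
    proof
      fix z assume "z \<in> {x} + S + ({y} + S)"
      then obtain s t where st: "s \<in> S" "t \<in> S" "z = (x + s) + (y + t)"
        by (auto simp: set_plus_def)
      then have "z = (x + y) + (s + t)" "s + t \<in> S"
        using assms(1) by (auto simp: subsemigroup_def algebra_simps)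
      then show "z \<in> U" using U xy openin_semigroup_topology_iff(1)[OF assms] by blast
    qed
    then have "({x} + S) \<times> ({y} + S) \<subseteq> {p. fst p + snd p \<in> U}"
      by (auto intro: set_plus_intro)
    moreover have "z \<in> {z} + S" for z
      using assms(2) by (metis add.right_neutral set_plus_intro singletonI)
    ultimately show "\<exists>V W. openin ?X V \<and> openin ?X W \<and> x \<in> V \<and> y \<in> W \<and>
        V \<times> W \<subseteq> {p. fst p + snd p \<in> U}"
      using op by blast
  qed
  then show ?thesis
    by (simp add: continuous_map_def topspace_semigroup_topology[OF assms] case_prod_beta)
qed

end

(*
  The sets x + S are the smallest neighbourhoods of the points of G_S, so every condition is a
  statement about translates of S.  The core is that (8) gives (7): for c_0, c_1, ... in S some a in S
  lies in d_n + S for infinitely many n, where d_n = c_0 + ... + c_n; since d_n + S is contained in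
  c_i + S for i \<le> n, this a works for all c_i at once.  For (3), the points are first
  clustered with respect to the cosets of S - S, using that powers of G_{S-S}, whose topology is
  finite, are compact; (6) then turns a cluster point modulo S - S, coordinate by coordinate, into
  a cluster point in the power of G_S.
*)
theory Submission
  imports Defs
begin

section \<open>Cluster points of sequences in general spaces\<close>

lemma finite_openin_imp_compact_space:
  assumes "finite {U. openin X U}"
  shows "compact_space X"
  unfolding compact_space_alt
proof (intro allI impI)
  fix \<U> assume "(\<forall>U\<in>\<U>. openin X U) \<and> topspace X \<subseteq> \<Union>\<U>"
  with finite_subset[OF _ assms, of \<U>]
  show "\<exists>\<F>. finite \<F> \<and> \<F> \<subseteq> \<U> \<and> topspace X \<subseteq> \<Union>\<F>"
    by blast
qed

text \<open>The closures of the tails form a decreasing sequence of nonempty closed sets, and any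
  common point is a cluster point. Indices are counted rather than values, so sequences with
  repetitions are covered.\<close>

lemma compact_space_sequence_cluster:
  fixes f :: "nat \<Rightarrow> 'b"
  assumes "compact_space X" and f: "range f \<subseteq> topspace X"
  obtains y where "y \<in> topspace X" "\<And>U. openin X U \<Longrightarrow> y \<in> U \<Longrightarrow> infinite {n. f n \<in> U}"
proof -
  define K where "K n = X closure_of (f ` {n..})" for n
  have "(\<Inter>n. K n) \<noteq> {}"
  proof (rule compact_space_imp_nest[OF assms(1)])
    show "closedin X (K n)" for n by (simp add: K_def)
    have "f n \<in> K n" for n
      unfolding K_def using f by (intro subsetD[OF closure_of_subset]) auto
    then show "K n \<noteq> {}" for n by blast
    show "decseq K"
      unfolding K_def decseq_def by (auto intro!: closure_of_mono)
  qed
  then obtain y where y: "y \<in> K n" for n by blast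
  have "infinite {n. f n \<in> U}" if "openin X U" "y \<in> U" for U
    unfolding infinite_nat_iff_unbounded_le
  proof
    fix m
    show "\<exists>n\<ge>m. n \<in> {n. f n \<in> U}"
      using y[of m] that unfolding K_def in_closure_of by auto
  qed
  moreover have "y \<in> topspace X"
    using y[of 0] by (simp add: K_def in_closure_of)
  ultimately show ?thesis using that by blast
qed

text \<open>Every infinite set contains the range of an injective sequence, and along such a
  sequence infinitely many indices amount to infinitely many points. The form with sequences makes
  cluster point arguments applicable.\<close>

lemma countably_compact_space_iff_sequences:
  "countably_compact_space X \<longleftrightarrow>
     (\<forall>f::nat \<Rightarrow> 'a. inj f \<and> range f \<subseteq> topspace X \<longrightarrow>
        (\<exists>x\<in>topspace X. \<forall>U. openin X U \<and> x \<in> U \<longrightarrow> infinite {n. f n \<in> U}))"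
    (is "_ \<longleftrightarrow> ?R")
proof
  assume X: "countably_compact_space X"
  show ?R
  proof (intro allI impI)
    fix f :: "nat \<Rightarrow> 'a" assume f: "inj f \<and> range f \<subseteq> topspace X"
    then have "infinite (range f)" using range_inj_infinite by blast
    with X f obtain x where x: "x \<in> topspace X"
      "\<And>U. openin X U \<Longrightarrow> x \<in> U \<Longrightarrow> infinite (U \<inter> range f)"
      unfolding countably_compact_space_def by metis
    have "U \<inter> range f = f ` {n. f n \<in> U}" for U by auto
    with x show "\<exists>x\<in>topspace X. \<forall>U. openin X U \<and> x \<in> U \<longrightarrow> infinite {n. f n \<in> U}"
      by (metis finite_imageI)
  qed
next
  assume R: ?R
  show "countably_compact_space X"
    unfolding countably_compact_space_def
  proof (intro allI impI)
    fix B assume B: "B \<subseteq> topspace X \<and> infinite B"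
    then obtain f :: "nat \<Rightarrow> 'a" where f: "inj f" "range f \<subseteq> B"
      using infinite_countable_subset by blast
    with B R obtain x where x: "x \<in> topspace X"
      "\<And>U. openin X U \<Longrightarrow> x \<in> U \<Longrightarrow> infinite {n. f n \<in> U}"
      by (metis subset_trans)
    have "infinite (U \<inter> B)" if "infinite {n. f n \<in> U}" for U
    proof
      assume "finite (U \<inter> B)"
      moreover have "f ` {n. f n \<in> U} \<subseteq> U \<inter> B" using f by auto
      ultimately show False
        using that f(1) by (meson finite_imageD finite_subset inj_on_subset subset_UNIV)
    qed
    with x show "\<exists>x\<in>topspace X. \<forall>U. openin X U \<and> x \<in> U \<longrightarrow> infinite (U \<inter> B)"
      by blast
  qed
qed

lemma sequentially_compact_imp_countably_compact:
  assumes "sequentially_compact_space X"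
  shows "countably_compact_space X"
  unfolding countably_compact_space_iff_sequences
proof (intro allI impI)
  fix f :: "nat \<Rightarrow> 'a" assume "inj f \<and> range f \<subseteq> topspace X"
  with assms obtain l r where r: "strict_mono r" "limitin X (f \<circ> r) l sequentially"
    unfolding sequentially_compact_space_def by blast
  have "infinite {n. f n \<in> U}" if U: "openin X U" "l \<in> U" for U
    unfolding infinite_nat_iff_unbounded_le
  proof
    fix m
    obtain N where "\<And>n. n \<ge> N \<Longrightarrow> f (r n) \<in> U"
      using r(2) U by (auto simp: limitin_sequentially)
    \<comment> \<open>The index \<open>max m N\<close> is late enough for the limit, and
      \<open>r n \<ge> n\<close> carries it beyond \<open>m\<close>.\<close>
    then have "f (r (max m N)) \<in> U" by simp
    moreover have "m \<le> r (max m N)"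
      using strict_mono_imp_increasing[OF r(1), of "max m N"] by simp
    ultimately show "\<exists>n\<ge>m. n \<in> {n. f n \<in> U}" by blast
  qed
  moreover have "l \<in> topspace X" using r(2) by (rule limitin_topspace)
  ultimately show "\<exists>x\<in>topspace X. \<forall>U. openin X U \<and> x \<in> U \<longrightarrow> infinite {n. f n \<in> U}"
    by (intro bexI[of _ l]) auto
qed

section \<open>Translates of \<open>S\<close> and the cosets of the subgroup of differences\<close>

lemma in_reflected_translate: "x \<in> reflected_translate a S \<longleftrightarrow> a - x \<in> S"
  by (force simp: reflected_translate_def)

lemma in_left_coset: "x \<in> a +o S \<longleftrightarrow> x - a \<in> (S::'a::ab_group_add set)"
  by (force simp: elt_set_plus_def)

context
  fixes S :: "'a::ab_group_add set"
  assumes S: "subsemigroup S" and zero: "0 \<in> S"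
begin

lemma add_closed: "x \<in> S \<Longrightarrow> y \<in> S \<Longrightarrow> x + y \<in> S"
  using S by (auto simp: subsemigroup_def)

lemma sum_closed: "(\<And>i. i \<in> A \<Longrightarrow> c i \<in> S) \<Longrightarrow> sum c A \<in> S"
  by (induction A rule: infinite_finite_induct) (auto simp: zero add_closed)

text \<open>The set is the translate \<open>x +o S\<close>. With
  \<open>translate_subset_open\<close> it is the least neighbourhood of \<open>x\<close>.\<close>

lemma openin_translate: "openin (semigroup_topology S) {y. y - x \<in> S}"
  unfolding openin_semigroup_topology_iff(1)[OF S zero]
  by (metis add_closed add_diff_eq add.commute mem_Collect_eq)

lemma translate_subset_open:
  assumes "openin (semigroup_topology S) U" "x \<in> U" "y - x \<in> S"
  shows "y \<in> U"
  using assms unfolding openin_semigroup_topology_iff(1)[OF S zero]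
  by (metis add.commute diff_add_cancel)

lemma subset_set_differences: "S \<subseteq> set_differences S"
  using zero by (force simp: set_differences_def)

lemma set_differences_diff:
  assumes "x \<in> set_differences S" "y \<in> set_differences S"
  shows "x - y \<in> set_differences S"
proof -
  obtain s t s' t' where st: "s \<in> S" "t \<in> S" "s' \<in> S" "t' \<in> S" "x = s - t" "y = s' - t'"
    using assms by (auto simp: set_differences_def)
  then have "x - y = (s + t') - (t + s')" by (simp add: algebra_simps)
  with st add_closed show ?thesis unfolding set_differences_def by blast
qed

lemma zero_set_differences: "0 \<in> set_differences S"
  using subset_set_differences zero by blast

lemma uminus_set_differences: "x \<in> set_differences S \<Longrightarrow> - x \<in> set_differences S"
  using set_differences_diff[OF zero_set_differences] by simp

lemma set_differences_add:
  "x \<in> set_differences S \<Longrightarrow> y \<in> set_differences S \<Longrightarrow> x + y \<in> set_differences S"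
  using set_differences_diff[OF _ uminus_set_differences] by simp

lemma subsemigroup_set_differences: "subsemigroup (set_differences S)"
  by (simp add: subsemigroup_def set_differences_add)

lemma coset_eq_iff:
  "x +o set_differences S = y +o set_differences S \<longleftrightarrow> x - y \<in> set_differences S"
proof
  assume "x +o set_differences S = y +o set_differences S"
  then show "x - y \<in> set_differences S"
    using zero_set_differences by (metis diff_self in_left_coset)
next
  assume xy: "x - y \<in> set_differences S"
  have "z - x \<in> set_differences S \<longleftrightarrow> z - y \<in> set_differences S" for z
    using set_differences_add[OF _ xy, of "z - x"] set_differences_diff[OF _ xy, of "z - y"]
    by auto
  then show "x +o set_differences S = y +o set_differences S"
    by (auto simp: in_left_coset)
qed

text \<open>An open set for the subgroup \<open>set_differences S\<close> is a union of its cosets.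
  Finite index leaves only finitely many such unions.\<close>

lemma compact_space_set_differences:
  assumes "finite_index (set_differences S)"
  shows "compact_space (semigroup_topology (set_differences S))"
proof (rule finite_openin_imp_compact_space)
  let ?H = "set_differences S"
  have "U = \<Union> ((\<lambda>x. x +o ?H) ` U)" if "openin (semigroup_topology ?H) U" for U
    using that zero_set_differences
    unfolding openin_semigroup_topology_iff(1)[OF subsemigroup_set_differences zero_set_differences]
    by (force simp: elt_set_plus_def)
  then have "{U. openin (semigroup_topology ?H) U} \<subseteq> Union ` Pow (range (\<lambda>x. x +o ?H))"
    by blast
  then show "finite {U. openin (semigroup_topology ?H) U}"
    by (rule finite_subset) (use assms in \<open>simp add: finite_index_def\<close>)
qed

text \<open>A pigeonhole principle for cosets: the sequence has a cluster point \<open>g\<close> in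
  the compact coset topology, and the coset of \<open>g\<close> is one of its
  neighbourhoods.\<close>

lemma finite_index_infinite_coset:
  fixes f :: "nat \<Rightarrow> 'a"
  assumes "finite_index (set_differences S)"
  obtains g where "infinite {n. f n - g \<in> set_differences S}"
proof -
  let ?H = "set_differences S"
  have top: "topspace (semigroup_topology ?H) = UNIV"
    using topspace_semigroup_topology[OF subsemigroup_set_differences zero_set_differences] .
  obtain g where g: "\<And>U. openin (semigroup_topology ?H) U \<Longrightarrow> g \<in> U \<Longrightarrow> infinite {n. f n \<in> U}"
    using compact_space_sequence_cluster[OF compact_space_set_differences[OF assms], of f]
    by (auto simp: top)
  have "openin (semigroup_topology ?H) {y. y - g \<in> ?H}"
    unfolding openin_semigroup_topology_iff(1)[OF subsemigroup_set_differences zero_set_differences]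
    by (metis set_differences_add add_diff_eq add.commute mem_Collect_eq)
  from g[OF this] have "infinite {n. f n - g \<in> ?H}"
    using zero_set_differences by simp
  then show ?thesis by (rule that)
qed

section \<open>Implications between the conditions on reflected translates\<close>

lemma infinite_reflected_translate_imp_countable:
  assumes *: "\<And>C. C \<subseteq> S \<Longrightarrow> infinite C \<Longrightarrow> \<exists>a\<in>S. infinite (C \<inter> reflected_translate a S)"
    and C: "C \<subseteq> S" "countable C"
  shows "\<exists>a\<in>S. C \<subseteq> reflected_translate a S"
proof (cases "C = {}")
  case True
  then show ?thesis using zero by blast
next
  case False
  with C(2) obtain c :: "nat \<Rightarrow> 'a" where c: "C = range c"
    using uncountable_def by blast
  then have cS: "c i \<in> S" for i using C(1) by auto
  \<comment> \<open>The partial sums form a chain: \<open>d n\<close> exceeds each earlier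
    \<open>c i\<close> by an element of \<open>S\<close>, so one bound for infinitely many
    \<open>d n\<close> bounds every \<open>c i\<close>.\<close>
  define d where "d n = sum c {..n}" for n
  have dS: "d n \<in> S" for n unfolding d_def using cS by (rule sum_closed)
  have dc: "d n - c i \<in> S" if "i \<le> n" for i n
  proof -
    have "d n = c i + sum c ({..n} - {i})"
      unfolding d_def using that by (intro sum.remove) auto
    then show ?thesis using cS sum_closed[of "{..n} - {i}" c] by simp
  qed
  have "\<exists>a\<in>S. infinite {n. a - d n \<in> S}"
  \<comment> \<open>The hypothesis speaks of infinite sets only. If \<open>d\<close> takes finitely
    many values, one of them recurs infinitely often and serves as \<open>a\<close> itself, because
    \<open>0 \<in> S\<close>.\<close>
  proof (cases "finite (range d)")
    case True
    then obtain m where "infinite {n. d n = d m}"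
      using pigeonhole_infinite[of UNIV d] by auto
    moreover have "{n. d n = d m} \<subseteq> {n. d m - d n \<in> S}" using zero by auto
    ultimately show ?thesis using dS finite_subset by blast
  next
    case False
    with *[of "range d"] dS obtain a
      where a: "a \<in> S" "infinite (range d \<inter> reflected_translate a S)" by blast
    have "range d \<inter> reflected_translate a S = d ` {n. a - d n \<in> S}"
      by (auto simp: in_reflected_translate)
    with a show ?thesis by (metis finite_imageI)
  qed
  then obtain a where a: "a \<in> S" "infinite {n. a - d n \<in> S}" by blast
  have "a - c i \<in> S" for i
  proof -
    obtain n where "i \<le> n" "a - d n \<in> S"
      using a(2) unfolding infinite_nat_iff_unbounded_le by blast
    \<comment> \<open>Here \<open>a - c i = (a - d n) + (d n - c i)\<close>.\<close>
    with add_closed[OF this(2) dc[OF this(1)]] show ?thesis by simp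
  qed
  then have "C \<subseteq> reflected_translate a S" by (auto simp: c in_reflected_translate)
  with a(1) show ?thesis by blast
qed

text \<open>Write each \<open>x\<close> in \<open>C\<close> as a difference with first term
  \<open>s x\<close>, so that \<open>s x - x \<in> S\<close>. A bound \<open>a\<close> for the
  elements \<open>s x\<close> also bounds \<open>C\<close>, since
  \<open>a - x = (a - s x) + (s x - x)\<close>.\<close>

lemma countable_reflected_translate_differences:
  assumes *: "\<forall>C. C \<subseteq> S \<and> countable C \<longrightarrow> (\<exists>a\<in>S. C \<subseteq> reflected_translate a S)"
  shows "\<forall>C. C \<subseteq> set_differences S \<and> countable C \<longrightarrow> (\<exists>a\<in>S. C \<subseteq> reflected_translate a S)"
proof (intro allI impI)
  fix C assume C: "C \<subseteq> set_differences S \<and> countable C"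
  then have "\<forall>x\<in>C. \<exists>s\<in>S. s - x \<in> S"
    by (force simp: set_differences_def)
  then obtain s where s: "\<And>x. x \<in> C \<Longrightarrow> s x \<in> S \<and> s x - x \<in> S" by metis
  then have "s ` C \<subseteq> S \<and> countable (s ` C)" using C by auto
  with * obtain a where a: "a \<in> S" "s ` C \<subseteq> reflected_translate a S" by meson
  have "a - x \<in> S" if "x \<in> C" for x
    using add_closed[of "a - s x" "s x - x"] a s[OF that] that
    by (auto simp: in_reflected_translate)
  then have "C \<subseteq> reflected_translate a S" by (auto simp: in_reflected_translate)
  with a(1) show "\<exists>a\<in>S. C \<subseteq> reflected_translate a S" by blast
qed

text \<open>Any two elements of a set \<open>a - S\<close> differ by an element of
  \<open>set_differences S\<close>. A set of coset representatives therefore meets it in at most one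
  point, which is impossible if that set is infinite.\<close>

lemma infinite_reflected_translate_imp_finite_index:
  assumes *: "\<And>C::'a set. infinite C \<Longrightarrow> \<exists>a. infinite (C \<inter> reflected_translate a S)"
  shows "finite_index (set_differences S)"
proof (rule ccontr)
  let ?q = "\<lambda>x. x +o set_differences S"
  assume "\<not> finite_index (set_differences S)"
  \<comment> \<open>\<open>C\<close> contains exactly one representative of each coset.\<close>
  moreover obtain C where C: "inj_on ?q C" "?q ` C = range ?q"
    using subset_image_inj[of "range ?q" ?q UNIV] by auto
  ultimately have "infinite C"
    unfolding finite_index_def by (metis finite_imageI)
  from *[OF this] obtain a where a: "infinite (C \<inter> reflected_translate a S)" by blast
  have "x = y" if "x \<in> C" "y \<in> C" "a - x \<in> S" "a - y \<in> S" for x y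
  proof -
    have "(a - y) - (a - x) \<in> set_differences S"
      using that set_differences_def by blast
    then have "?q x = ?q y" by (simp add: coset_eq_iff)
    with C(1) that show ?thesis by (meson inj_onD)
  qed
  then have "C \<inter> reflected_translate a S \<subseteq> {x}" if "x \<in> C \<inter> reflected_translate a S" for x
    using that by (auto simp: in_reflected_translate)
  with a show False
    by (metis finite.emptyI finite_insert finite_subset ex_in_conv)
qed

lemma infinite_reflected_translate_imp_subset_semigroup:
  assumes *: "\<forall>C::'a set. infinite C \<longrightarrow> (\<exists>a. infinite (C \<inter> reflected_translate a S))"
  shows "finite_index (set_differences S) \<and>
    (\<forall>C. C \<subseteq> S \<and> infinite C \<longrightarrow> (\<exists>a\<in>S. infinite (C \<inter> reflected_translate a S)))"
proof (intro conjI allI impI)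
  show "finite_index (set_differences S)"
    using * infinite_reflected_translate_imp_finite_index by blast
  fix C assume C: "C \<subseteq> S \<and> infinite C"
  with * obtain a where a: "infinite (C \<inter> reflected_translate a S)" by blast
  then obtain x where "x \<in> C" "a - x \<in> S"
    by (metis IntE ex_in_conv finite.emptyI in_reflected_translate)
  \<comment> \<open>A single common point \<open>x\<close> of \<open>C\<close> and
    \<open>a - S\<close> forces \<open>a = (a - x) + x\<close> into \<open>S\<close>.\<close>
  with C have "a \<in> S" using add_closed[of "a - x" x] by auto
  with a show "\<exists>a\<in>S. infinite (C \<inter> reflected_translate a S)" by blast
qed

section \<open>Sequential compactness and countable compactness of powers\<close>

text \<open>Reflection turns upper bounds into lower ones: if \<open>a\<close> bounds all
  \<open>g - x\<close> from above, then \<open>x - (g - a) = a - (g - x)\<close> lies in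
  \<open>S\<close>, so \<open>l = g - a\<close> works.\<close>

lemma countable_coset_subset_translate:
  assumes *: "\<forall>C. C \<subseteq> set_differences S \<and> countable C \<longrightarrow>
      (\<exists>a\<in>S. C \<subseteq> reflected_translate a S)"
    and B: "countable B" "\<And>x. x \<in> B \<Longrightarrow> x - g \<in> set_differences S"
  obtains l where "\<And>x. x \<in> B \<Longrightarrow> x - l \<in> S"
proof -
  have "(\<lambda>x. g - x) ` B \<subseteq> set_differences S"
    using B(2) uminus_set_differences by fastforce
  with * B(1) obtain a where a: "(\<lambda>x. g - x) ` B \<subseteq> reflected_translate a S"
    by (meson countable_image)
  have "x - (g - a) \<in> S" if "x \<in> B" for x
    using a that by (auto simp: in_reflected_translate algebra_simps)
  then show ?thesis by (rule that)
qed

lemma sequentially_compact_space_semigroup_topology: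
  assumes "finite_index (set_differences S)"
    and *: "\<forall>C. C \<subseteq> set_differences S \<and> countable C \<longrightarrow>
      (\<exists>a\<in>S. C \<subseteq> reflected_translate a S)"
  shows "sequentially_compact_space (semigroup_topology S)"
  unfolding sequentially_compact_space_def
proof (intro allI impI)
  fix f :: "nat \<Rightarrow> 'a"
  obtain g where g: "infinite {n. f n - g \<in> set_differences S}"
    using finite_index_infinite_coset[OF assms(1)] .
  obtain r where r: "strict_mono r" "\<And>n::nat. r n \<in> {n. f n - g \<in> set_differences S}"
    using infinite_enumerate[OF g] by blast
  \<comment> \<open>The whole subsequence lies in the least neighbourhood of \<open>l\<close>, hence
    in every neighbourhood, and so converges to \<open>l\<close>.\<close>
  obtain l where "\<And>x. x \<in> range (f \<circ> r) \<Longrightarrow> x - l \<in> S"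
    using countable_coset_subset_translate[OF *, of "range (f \<circ> r)" g] r(2) by auto
  then have "limitin (semigroup_topology S) (f \<circ> r) l sequentially"
    unfolding limitin_def topspace_semigroup_topology[OF S zero]
    using translate_subset_open by (auto intro!: always_eventually)
  with r(1) show "\<exists>l r. strict_mono r \<and> limitin (semigroup_topology S) (f \<circ> r) l sequentially"
    by blast
qed

lemma countably_compact_space_power:
  assumes "finite_index (set_differences S)"
    and *: "\<forall>C. C \<subseteq> set_differences S \<and> countable C \<longrightarrow>
      (\<exists>a\<in>S. C \<subseteq> reflected_translate a S)"
  shows "countably_compact_space (product_topology (\<lambda>_. semigroup_topology S) I)"
  unfolding countably_compact_space_iff_sequences
proof (intro allI impI)
  let ?H = "set_differences S"
  let ?X = "product_topology (\<lambda>_. semigroup_topology S) I"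
  let ?Y = "product_topology (\<lambda>_. semigroup_topology ?H) I"
  note top = topspace_semigroup_topology[OF S zero]
    topspace_semigroup_topology[OF subsemigroup_set_differences zero_set_differences]
  fix f :: "nat \<Rightarrow> _"
  assume "inj f \<and> range f \<subseteq> topspace ?X"
  then have f: "range f \<subseteq> topspace ?Y" by (simp add: top)
  have "compact_space ?Y"
    using compact_space_set_differences[OF assms(1)] by (simp add: compact_space_product_topology)
  from compact_space_sequence_cluster[OF this f] obtain y where y: "y \<in> topspace ?Y"
    "\<And>U. openin ?Y U \<Longrightarrow> y \<in> U \<Longrightarrow> infinite {n. f n \<in> U}" by blast
  \<comment> \<open>In coordinate \<open>i\<close>, only countably many values \<open>f n i\<close>
    lie in the coset of \<open>y i\<close>, so one \<open>l\<close> serves all of them. It does not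
    depend on the neighbourhood considered later.\<close>
  have "\<exists>l. \<forall>n. f n i - y i \<in> ?H \<longrightarrow> f n i - l \<in> S" for i
  proof -
    define B where "B = (\<lambda>n. f n i) ` {n. f n i - y i \<in> ?H}"
    have "countable B" "\<And>x. x \<in> B \<Longrightarrow> x - y i \<in> ?H" by (auto simp: B_def)
    from countable_coset_subset_translate[OF * this]
    obtain l where "\<And>x. x \<in> B \<Longrightarrow> x - l \<in> S" by blast
    then show ?thesis unfolding B_def by blast
  qed
  then obtain l where l: "\<And>i n. f n i - y i \<in> ?H \<Longrightarrow> f n i - l i \<in> S" by metis
  define x where "x = restrict l I"
  have inf: "infinite {n. f n \<in> U}" if U: "openin ?X U" "x \<in> U" for U
  proof -
    obtain V where V: "finite {i \<in> I. V i \<noteq> UNIV}" "\<And>i. i \<in> I \<Longrightarrow> openin (semigroup_topology S) (V i)"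
      "x \<in> Pi\<^sub>E I V" "Pi\<^sub>E I V \<subseteq> U"
      using U(1)[unfolded openin_product_topology_alt top, rule_format, OF U(2)] by blast
    \<comment> \<open>The box \<open>W\<close> restricts the same finitely many coordinates as
      \<open>V\<close>, but only up to cosets. It is thus a neighbourhood of \<open>y\<close> in
      \<open>?Y\<close>, and the choice of \<open>l\<close> takes every term in \<open>W\<close>
      into \<open>V\<close>.\<close>
    define W where "W i = (if V i = UNIV then UNIV else {z. z - y i \<in> ?H})" for i
    have "openin (semigroup_topology ?H) (W i)" for i
      unfolding W_def openin_semigroup_topology_iff(1)[OF subsemigroup_set_differences zero_set_differences]
      by (auto simp: diff_add_eq[symmetric] set_differences_add)
    moreover have "finite {i \<in> I. W i \<noteq> UNIV}"
      by (rule finite_subset[OF _ V(1)]) (auto simp: W_def)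
    ultimately have "openin ?Y (Pi\<^sub>E I W)"
      by (simp add: openin_PiE_gen top)
    moreover have "y \<in> Pi\<^sub>E I W"
      using y(1) zero_set_differences by (auto simp: W_def top)
    ultimately have infW: "infinite {n. f n \<in> Pi\<^sub>E I W}" by (rule y(2))
    have "f n \<in> U" if n: "f n \<in> Pi\<^sub>E I W" for n
    proof (rule subsetD[OF V(4) PiE_I])
      fix i assume i: "i \<in> I"
      show "f n i \<in> V i"
      proof (cases "V i = UNIV")
        case False
        have "f n i \<in> W i" using n i by (rule PiE_mem)
        with False have "f n i - y i \<in> ?H" by (simp add: W_def)
        then have "f n i - l i \<in> S" by (rule l)
        moreover have "l i \<in> V i" using V(3) i by (auto simp: x_def)
        ultimately show ?thesis using translate_subset_open[OF V(2)[OF i]] by blast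
      qed simp
    next
      show "f n i = undefined" if "i \<notin> I" for i using n that by (auto simp: PiE_iff extensional_def)
    qed
    then have "{n. f n \<in> Pi\<^sub>E I W} \<subseteq> {n. f n \<in> U}" by (rule Collect_mono[rule_format])
    then show ?thesis using infW by (rule infinite_super)
  qed
  show "\<exists>x\<in>topspace ?X. \<forall>U. openin ?X U \<and> x \<in> U \<longrightarrow> infinite {n. f n \<in> U}"
  proof (intro bexI allI impI)
    show "infinite {n. f n \<in> U}" if "openin ?X U \<and> x \<in> U" for U
      using inf[of U] that by (elim conjE)
    show "x \<in> topspace ?X" by (simp add: x_def top)
  qed
qed

text \<open>Apply countable compactness to the negatives of \<open>C\<close>: an accumulation point
  \<open>x\<close> has infinitely many of them in its least neighbourhood \<open>x + S\<close>, and
  negation carries these to points of \<open>C\<close> in \<open>- x - S\<close>.\<close>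

lemma countably_compact_imp_infinite_reflected_translate:
  assumes "countably_compact_space (semigroup_topology S)" and C: "infinite (C::'a set)"
  shows "\<exists>a. infinite (C \<inter> reflected_translate a S)"
proof -
  have "infinite (uminus ` C)" using C by (simp add: finite_image_iff)
  with assms(1) obtain x where
    x: "\<And>U. openin (semigroup_topology S) U \<Longrightarrow> x \<in> U \<Longrightarrow> infinite (U \<inter> uminus ` C)"
    unfolding countably_compact_space_def topspace_semigroup_topology[OF S zero] by blast
  have "infinite ({y. y - x \<in> S} \<inter> uminus ` C)"
    using x[OF openin_translate] zero by simp
  moreover have "{y. y - x \<in> S} \<inter> uminus ` C = uminus ` (C \<inter> reflected_translate (- x) S)"
    by (auto simp: in_reflected_translate minus_diff_commute[of x] intro!: imageI)
  ultimately show ?thesis by (metis finite_imageI)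
qed

text \<open>The power over a one-point index set is a copy of the space itself. As types are
  nonempty, such a set exists in any index type.\<close>

lemma countably_compact_space_if_power:
  assumes "\<forall>I::'i set. countably_compact_space (product_topology (\<lambda>_. semigroup_topology S) I)"
  shows "countably_compact_space (semigroup_topology S)"
  unfolding countably_compact_space_iff_sequences
proof (intro allI impI)
  let ?X = "semigroup_topology S"
  fix k :: 'i
  fix f :: "nat \<Rightarrow> 'a" assume f: "inj f \<and> range f \<subseteq> topspace ?X"
  let ?P = "product_topology (\<lambda>_. ?X) {k}"
  define h where "h n = (\<lambda>i\<in>{k}. f n)" for n
  have hk: "h n k = f n" for n by (simp add: h_def)
  then have "inj h" using f by (metis injD injI)
  moreover have "range h \<subseteq> topspace ?P" using f by (auto simp: h_def split: if_splits)
  ultimately obtain x where x: "x \<in> topspace ?P"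
    "\<And>U. openin ?P U \<Longrightarrow> x \<in> U \<Longrightarrow> infinite {n. h n \<in> U}"
    using assms[rule_format, of "{k}"] unfolding countably_compact_space_iff_sequences by metis
  have "infinite {n. f n \<in> U}" if U: "openin ?X U" "x k \<in> U" for U
  proof -
    have "openin ?P {z \<in> topspace ?P. z k \<in> U}"
      by (rule openin_continuous_map_preimage[OF _ U(1)])
        (rule continuous_map_product_projection, simp)
    from x(2)[OF this] x(1) U(2) have "infinite {n. h n \<in> topspace ?P \<and> h n k \<in> U}" by simp
    moreover have "{n. h n \<in> topspace ?P \<and> h n k \<in> U} \<subseteq> {n. f n \<in> U}" by (auto simp: hk)
    ultimately show ?thesis using finite_subset by blast
  qed
  moreover have "x k \<in> topspace ?X" using x(1) by auto
  ultimately show "\<exists>x\<in>topspace ?X. \<forall>U. openin ?X U \<and> x \<in> U \<longrightarrow> infinite {n. f n \<in> U}"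
    by (intro bexI[of _ "x k"]) auto
qed

section \<open>Decreasing sequences of open sets\<close>

text \<open>Choose a point in each \<open>U n\<close> and keep the infinitely many in one coset. A
  common upper bound of these lies in the corresponding open sets, and by monotonicity in all of
  them.\<close>

lemma countably_o_compact_semigroup_topology:
  assumes "finite_index (set_differences S)"
    and *: "\<forall>C. C \<subseteq> set_differences S \<and> countable C \<longrightarrow>
      (\<exists>a\<in>S. C \<subseteq> reflected_translate a S)"
  shows "countably_o_compact_space (semigroup_topology S)"
  unfolding countably_o_compact_space_def
proof (intro allI impI)
  fix U :: "nat \<Rightarrow> 'a set"
  assume U: "(\<forall>n. openin (semigroup_topology S) (U n) \<and> U n \<noteq> {}) \<and> decseq U"
  then have "\<forall>n. \<exists>z. z \<in> U n" by blast
  then obtain x where x: "\<And>n. x n \<in> U n" by metis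
  obtain g where g: "infinite {n. x n - g \<in> set_differences S}"
    using finite_index_infinite_coset[OF assms(1)] .
  define C where "C = (\<lambda>n. x n - g) ` {n. x n - g \<in> set_differences S}"
  have "C \<subseteq> set_differences S \<and> countable C" by (auto simp: C_def)
  with * obtain a where a: "C \<subseteq> reflected_translate a S" by blast
  have "a + g \<in> U m" for m
  proof -
    obtain n where n: "m \<le> n" "x n - g \<in> set_differences S"
      using g[unfolded infinite_nat_iff_unbounded_le, rule_format, of m] by auto
    with a have "a - (x n - g) \<in> S" by (auto simp: C_def in_reflected_translate)
    then have "a + g - x n \<in> S" by (simp add: algebra_simps)
    then have "a + g \<in> U n" using translate_subset_open x U by blast
    with n(1) U show ?thesis by (auto simp: decseq_def)
  qed
  then show "(\<Inter>n. U n) \<noteq> {}" by blast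
qed

lemma countably_o_compact_imp_infinite_reflected_translate:
  assumes "countably_o_compact_space (semigroup_topology S)" and C: "infinite (C::'a set)"
  shows "\<exists>a. infinite (C \<inter> reflected_translate a S)"
proof -
  obtain c :: "nat \<Rightarrow> 'a" where c: "inj c" "range c \<subseteq> C"
    using C infinite_countable_subset by blast
  \<comment> \<open>\<open>U n\<close> is the least open set containing the tail of \<open>c\<close>
    from \<open>n\<close> on. A point common to all \<open>U n\<close> lies above infinitely many
    terms \<open>c k\<close>.\<close>
  define U where "U n = (\<Union>k\<in>{n..}. {y. y - c k \<in> S})" for n
  have "openin (semigroup_topology S) (U n)" for n
    unfolding U_def using openin_translate by blast
  moreover have "c n \<in> U n" for n using zero by (force simp: U_def)
  moreover have "decseq U" by (fastforce simp: U_def decseq_def)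
  ultimately obtain a where a: "\<And>n. a \<in> U n"
    using assms(1) unfolding countably_o_compact_space_def by (metis INT_E UNIV_I ex_in_conv)
  have "infinite {k. a - c k \<in> S}"
    unfolding infinite_nat_iff_unbounded_le using a by (auto simp: U_def)
  then have "infinite (c ` {k. a - c k \<in> S})"
    using c(1) by (meson finite_imageD inj_on_subset subset_UNIV)
  moreover have "c ` {k. a - c k \<in> S} \<subseteq> C \<inter> reflected_translate a S"
    using c(2) by (auto simp: in_reflected_translate)
  ultimately show ?thesis using finite_subset by blast
qed

text \<open>Negatives of open sets are closed: if \<open>x + S\<close> contains \<open>- u\<close>
  with \<open>u \<in> U\<close>, then \<open>- x \<in> u + S\<close>, which is contained in
  \<open>U\<close>.\<close>

lemma closure_of_uminus_open:
  assumes "openin (semigroup_topology S) U"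
  shows "semigroup_topology S closure_of (uminus ` U) = uminus ` U"
proof
  show "semigroup_topology S closure_of (uminus ` U) \<subseteq> uminus ` U"
  proof
    fix x assume "x \<in> semigroup_topology S closure_of (uminus ` U)"
    then have "\<forall>T. x \<in> T \<and> openin (semigroup_topology S) T \<longrightarrow> (\<exists>v. v \<in> uminus ` U \<and> v \<in> T)"
      unfolding in_closure_of by (rule conjunct2)
    from this[rule_format, of "{y. y - x \<in> S}"] openin_translate[of x] zero
    obtain u where u: "u \<in> U" "- u - x \<in> S" by auto
    have "- x - u \<in> S" using u(2) by (simp add: minus_diff_commute)
    with assms u(1) have "- x \<in> U" by (rule translate_subset_open)
    then show "x \<in> uminus ` U" by force
  qed
  show "uminus ` U \<subseteq> semigroup_topology S closure_of (uminus ` U)"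
    by (rule closure_of_subset) (simp add: topspace_semigroup_topology[OF S zero])
qed

text \<open>The closures add nothing, and negation is a bijection, so the intersection of the
  closures is the negative of the intersection of the \<open>U n\<close>.\<close>

lemma two_pseudocompact_iff_countably_o_compact:
  "two_pseudocompact (semigroup_topology S) \<longleftrightarrow>
    countably_o_compact_space (semigroup_topology S)"
proof -
  have "(\<Inter>n. semigroup_topology S closure_of (uminus ` U n)) = uminus ` (\<Inter>n. U n)"
    if "\<forall>n. openin (semigroup_topology S) (U n) \<and> U n \<noteq> {}" for U :: "nat \<Rightarrow> 'a set"
    using that by (simp add: closure_of_uminus_open image_INT[of uminus UNIV])
  then show ?thesis
    unfolding two_pseudocompact_def countably_o_compact_space_def by (metis image_is_empty)
qed

end

section \<open>Assembly of the equivalences\<close>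

theorem proposition5p9:
  fixes S :: "'a::ab_group_add set"
  assumes "subsemigroup S" and "0 \<in> S"
  shows
    "(sequentially_compact_space (semigroup_topology S) \<longleftrightarrow>
        countably_compact_space (semigroup_topology S)) \<and>
     (sequentially_compact_space (semigroup_topology S) \<longleftrightarrow>
        (\<forall>I::'i set. countably_compact_space (product_topology (\<lambda>_. semigroup_topology S) I))) \<and>
     (sequentially_compact_space (semigroup_topology S) \<longleftrightarrow>
        countably_o_compact_space (semigroup_topology S)) \<and>
     (sequentially_compact_space (semigroup_topology S) \<longleftrightarrow>
        two_pseudocompact (semigroup_topology S)) \<and>
     (sequentially_compact_space (semigroup_topology S) \<longleftrightarrow>
        finite_index (set_differences S) \<and>
        (\<forall>C. C \<subseteq> set_differences S \<and> countable C \<longrightarrow>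
           (\<exists>a\<in>S. C \<subseteq> reflected_translate a S))) \<and>
     (sequentially_compact_space (semigroup_topology S) \<longleftrightarrow>
        finite_index (set_differences S) \<and>
        (\<forall>C. C \<subseteq> S \<and> countable C \<longrightarrow> (\<exists>a\<in>S. C \<subseteq> reflected_translate a S))) \<and>
     (sequentially_compact_space (semigroup_topology S) \<longleftrightarrow>
        finite_index (set_differences S) \<and>
        (\<forall>C. C \<subseteq> S \<and> infinite C \<longrightarrow> (\<exists>a\<in>S. infinite (C \<inter> reflected_translate a S)))) \<and>
     (sequentially_compact_space (semigroup_topology S) \<longleftrightarrow>
        (\<forall>C::'a set. infinite C \<longrightarrow> (\<exists>a. infinite (C \<inter> reflected_translate a S))))"
proof -
  let ?X = "semigroup_topology S"
  let ?H = "finite_index (set_differences S)"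
  let ?c6 = "\<forall>C. C \<subseteq> set_differences S \<and> countable C \<longrightarrow> (\<exists>a\<in>S. C \<subseteq> reflected_translate a S)"
  let ?c7 = "\<forall>C. C \<subseteq> S \<and> countable C \<longrightarrow> (\<exists>a\<in>S. C \<subseteq> reflected_translate a S)"
  let ?c8 = "\<forall>C. C \<subseteq> S \<and> infinite C \<longrightarrow> (\<exists>a\<in>S. infinite (C \<inter> reflected_translate a S))"
  let ?c9 = "\<forall>C::'a set. infinite C \<longrightarrow> (\<exists>a. infinite (C \<inter> reflected_translate a S))"
  let ?c3 = "\<forall>I::'i set. countably_compact_space (product_topology (\<lambda>_. ?X) I)"
  \<comment> \<open>Each two-digit label names the implication from its first condition to its
    second, except that \<open>45\<close> is an equivalence. The main cycle is 1, 2, 9, 8, 7, 6, 1;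
    condition 3 is inserted between 6 and 2, and condition 4 between 6 and 9. The finite index
    \<open>?H\<close> is carried along from 8 to 6.\<close>
  have 12: "sequentially_compact_space ?X \<Longrightarrow> countably_compact_space ?X"
    by (rule sequentially_compact_imp_countably_compact)
  have 29: "countably_compact_space ?X \<Longrightarrow> ?c9"
    by (intro allI impI countably_compact_imp_infinite_reflected_translate[OF assms])
  have 98: "?c9 \<Longrightarrow> ?H \<and> ?c8"
    by (rule infinite_reflected_translate_imp_subset_semigroup[OF assms])
  have 87: "?c8 \<Longrightarrow> ?c7"
    using infinite_reflected_translate_imp_countable[OF assms] by blast
  have 76: "?c7 \<Longrightarrow> ?c6"
    by (rule countable_reflected_translate_differences[OF assms])
  have 61: "?H \<Longrightarrow> ?c6 \<Longrightarrow> sequentially_compact_space ?X"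
    by (rule sequentially_compact_space_semigroup_topology[OF assms])
  have 63: "?H \<Longrightarrow> ?c6 \<Longrightarrow> ?c3"
    by (rule allI) (rule countably_compact_space_power[OF assms])
  have 32: "?c3 \<Longrightarrow> countably_compact_space ?X"
    by (rule countably_compact_space_if_power[OF assms])
  have 64: "?H \<Longrightarrow> ?c6 \<Longrightarrow> countably_o_compact_space ?X"
    by (rule countably_o_compact_semigroup_topology[OF assms])
  have 49: "countably_o_compact_space ?X \<Longrightarrow> ?c9"
    by (intro allI impI countably_o_compact_imp_infinite_reflected_translate[OF assms])
  have 45: "two_pseudocompact ?X \<longleftrightarrow> countably_o_compact_space ?X"
    by (rule two_pseudocompact_iff_countably_o_compact[OF assms])
  show ?thesis
    using 12 29 98 87 76 61 63 32 64 49 45 by argo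
qed

end
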